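(* Consider the system of $N$ interacting reinforced stochastic processes $(\mathbf{Z}_n)_{n\ge 0}$ described in the context (with $W$ nonnegative, $W^{\top}\mathbf{1}=\mathbf{1}$, irreducible and diagonalizable, and $\lim_n n^{\gamma}r_n=c$ with $c>0$, $1/2<\gamma\le 1$). Then there exists a random variable $Z_\infty$ with values in $[0,1]$ such that $$\mathbf{Z}_n \xrightarrow{a.s.} Z_\infty\mathbf{1}\qquad (n\to\infty).$$
   Context: Model. Let $N\ge 1$ be an integer and let $\mathbf{1}\in\mathbb{R}^N$ be the vector of all ones. Let $W=[w_{j,k}]$ be a real $N\times N$ matrix with $w_{j,k}\ge 0$ and $W^{\top}\mathbf{1}=\mathbf{1}$ (i.e. $\sum_{j=1}^N w_{j,k}=1$ for every $k$). Assume that $W$ is irreducible and diagonalizable (over $\mathbb{C}$). Let $(r_n)_{n\ge 0}$ be real constants with $0\le r_n<1$ such that $\lim_n n^{\gamma}r_n=c$ for some $c>0$ and $1/2<\gamma\le 1$. On a probability space let $\mathbf{Z}_0=(Z_{0,1},\dots,Z_{0,N})^{\top}$ be a (possibly random) vector with values in $[0,1]^N$, and let $\mathbf{X}_n=(X_{n,1},\dots,X_{n,N})^{\top}$, $n\ge 1$, be $\{0,1\}^N$-valued random vectors. Put $\mathcal{F}_n=\sigma(\mathbf{Z}_0,\mathbf{X}_m: 1\le m\le n)$. For every $n\ge 0$, the variables $X_{n+1,1},\dots,X_{n+1,N}$ are conditionally independent given $\mathcal{F}_n$, with $P(X_{n+1,j}=1\mid\mathcal{F}_n)=\sum_{k=1}^N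 w_{k,j}Z_{n,k}$, and $\mathbf{Z}_{n+1}=(1-r_n)\mathbf{Z}_n+r_n\mathbf{X}_{n+1}$. *)

theory Defs
  imports "HOL-Probability.Probability"
begin

text \<open>A square matrix is irreducible if the directed graph on its index set that has an edge
  from \<open>i\<close> to \<open>j\<close> for every nonzero entry \<open>A $ i $ j\<close> is strongly connected.\<close>

definition irreducible_matrix :: "'a::zero ^ 'n ^ 'n \<Rightarrow> bool" where
  "irreducible_matrix A \<longleftrightarrow> (\<forall>i j. (i, j) \<in> {(k, l). A $ k $ l \<noteq> 0}\<^sup>*)"

definition diagonalizable_matrix :: "'a::field ^ 'n ^ 'n \<Rightarrow> bool" where
  "diagonalizable_matrix A \<longleftrightarrow>
    (\<exists>P D :: 'a ^ 'n ^ 'n. invertible P \<and> (\<forall>i j. i \<noteq> j \<longrightarrow> D $ i $ j = 0) \<and> A = P ** D ** matrix_inv P)"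

text \<open>\<open>history_algebra M Y X n\<close> is the sub-\<open>\<sigma>\<close>-algebra \<open>\<sigma>(Y, X 1, \<dots>, X n)\<close>; the value \<open>X 0\<close> is
  not used. Its measure is zero, which is harmless: conditional expectations with respect to it
  (\<^const>\<open>real_cond_exp\<close>) only look at its measurable sets.\<close>

definition history_algebra ::
  "'a measure \<Rightarrow> ('a \<Rightarrow> 'b::topological_space) \<Rightarrow> (nat \<Rightarrow> 'a \<Rightarrow> 'b) \<Rightarrow> nat \<Rightarrow> 'a measure" where
  "history_algebra M Y X n = sigma (space M)
    ({Y -` A \<inter> space M | A. A \<in> sets borel} \<union>
     {X m -` A \<inter> space M | m A. m \<in> {1..n} \<and> A \<in> sets borel})"

definition cond_prob_given :: "'a measure \<Rightarrow> 'a measure \<Rightarrow> 'a set \<Rightarrow> 'a \<Rightarrow> real" where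
  "cond_prob_given M F E = real_cond_exp M F (indicator E)"

text \<open>Conditional independence given the sub-\<open>\<sigma>\<close>-algebra \<open>F\<close>, stated along the lines of
  \<^const>\<open>prob_space.indep_vars\<close>.\<close>

definition cond_indep_vars ::
  "'a measure \<Rightarrow> 'a measure \<Rightarrow> ('i \<Rightarrow> 'b measure) \<Rightarrow> ('i \<Rightarrow> 'a \<Rightarrow> 'b) \<Rightarrow> 'i set \<Rightarrow> bool" where
  "cond_indep_vars M F M' X I \<longleftrightarrow>
    (\<forall>i\<in>I. X i \<in> measurable M (M' i)) \<and>
    (\<forall>J\<subseteq>I. finite J \<longrightarrow> (\<forall>A. (\<forall>j\<in>J. A j \<in> sets (M' j)) \<longrightarrow>
      (AE \<omega> in M. cond_prob_given M F {\<eta> \<in> space M. \<forall>j\<in>J. X j \<eta> \<in> A j} \<omega> =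
        (\<Prod>j\<in>J. cond_prob_given M F {\<eta> \<in> space M. X j \<eta> \<in> A j} \<omega>))))"

end

theory Submission
  imports Defs
begin

text \<open>Since \<open>\<Sum> r n\<^sup>2 < \<infinity>\<close>, the martingale noise \<open>\<Sum> r n (X (n+1) - W\<^sup>T Z n)\<close> converges
  almost surely, by Kolmogorov's inequality. On each such path the rest is deterministic. Let \<open>p\<close> be
  the Perron vector of \<open>W\<close>. The weighted mean \<open>p \<bullet> Z n\<close> is driven by the noise alone and hence
  converges. The deviation of \<open>Z n\<close> from this mean, corrected by the tail of the noise series, is
  contracted in the \<open>p\<close>-weighted Euclidean norm by a factor \<open>1 - \<kappa> r n\<close> up to an error \<open>o(r n)\<close>,
  where \<open>\<kappa>\<close> comes from a Poincare inequality for the Dirichlet form of the irreducible matrix; it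
  vanishes in the limit because \<open>\<Sum> r n = \<infinity>\<close>.\<close>

subsection \<open>Perron vector and Poincare inequality\<close>

text \<open>The transpose fixes \<open>1\<close>, and a square matrix is singular together with its
  transpose, so \<open>W\<close> has a nonzero fixed vector \<open>v\<close>, possibly of mixed
  signs. Its entrywise absolute value is fixed as well; irreducibility makes it strictly positive,
  and dividing by the total mass normalizes it.\<close>

lemma perron_vector_exists:
  fixes W :: "real ^ 'n ^ 'n"
  assumes nonneg: "\<And>j k. 0 \<le> W $ j $ k"
    and stoch: "transpose W *v 1 = 1"
    and irr: "irreducible_matrix W"
  shows "\<exists>p :: real ^ 'n. (\<forall>i. 0 < p $ i) \<and> sum (($) p) UNIV = 1 \<and> W *v p = p"
proof -
  have col: "(\<Sum>j\<in>UNIV. W $ j $ k) = 1" for k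
    using arg_cong[OF stoch, of "\<lambda>v. v $ k"] by (simp add: matrix_vector_mult_def transpose_def)
  have "(transpose W - mat 1) *v 1 = 0"
    using stoch by (simp add: matrix_vector_mult_diff_rdistrib)
  moreover have "(1 :: real ^ 'n) \<noteq> 0" by (simp add: vec_eq_iff)
  moreover have "transpose (W - mat 1) = transpose W - mat 1"
    by (auto simp: transpose_def mat_def vec_eq_iff)
  ultimately have "\<not> invertible (transpose (W - mat 1))"
    unfolding invertible_left_inverse matrix_left_invertible_ker by metis
  then have "\<not> invertible (W - mat 1)"
    using transpose_invertible by blast
  then obtain v where v: "(W - mat 1) *v v = 0" "v \<noteq> 0"
    unfolding invertible_left_inverse matrix_left_invertible_ker by auto
  then have Wv: "W *v v = v"
    by (simp add: matrix_vector_mult_diff_rdistrib)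
  have Wv': "(\<Sum>k\<in>UNIV. W $ j $ k * v $ k) = v $ j" for j
    using arg_cong[OF Wv, of "\<lambda>v. v $ j"] by (simp add: matrix_vector_mult_def)
  \<comment> \<open>\<open>W \<bar>v\<bar> \<ge> \<bar>v\<bar>\<close> entrywise, and both sides have the same total mass, so equality holds.\<close>
  define a where "a j = \<bar>v $ j\<bar>" for j
  have le: "a j \<le> (\<Sum>k\<in>UNIV. W $ j $ k * a k)" for j
  proof -
    have "a j = \<bar>\<Sum>k\<in>UNIV. W $ j $ k * v $ k\<bar>" by (simp add: Wv' a_def)
    also have "\<dots> \<le> (\<Sum>k\<in>UNIV. \<bar>W $ j $ k * v $ k\<bar>)" by (rule sum_abs)
    also have "\<dots> = (\<Sum>k\<in>UNIV. W $ j $ k * a k)"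
      by (simp add: a_def abs_mult nonneg)
    finally show ?thesis .
  qed
  have "(\<Sum>j\<in>UNIV. \<Sum>k\<in>UNIV. W $ j $ k * a k) = (\<Sum>k\<in>UNIV. \<Sum>j\<in>UNIV. W $ j $ k * a k)"
    by (rule sum.swap)
  also have "\<dots> = (\<Sum>k\<in>UNIV. a k)" by (simp add: sum_distrib_right[symmetric] col)
  finally have "(\<Sum>j\<in>UNIV. (\<Sum>k\<in>UNIV. W $ j $ k * a k) - a j) = 0"
    by (simp add: sum_subtractf)
  then have Wa: "(\<Sum>k\<in>UNIV. W $ j $ k * a k) = a j" for j
    using le by (subst (asm) sum_nonneg_eq_0_iff) auto
  obtain j0 where j0: "v $ j0 \<noteq> 0" using v by (auto simp: vec_eq_iff)
  have pos: "0 < a i" for i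
  proof -
    \<comment> \<open>Positivity travels backwards along a path ending at \<open>j0\<close>: if
      \<open>W $ k $ l\<close> and \<open>a l\<close> are positive, then the fixed point equation
      for \<open>a k\<close> has a positive summand.\<close>
    have "(i, j0) \<in> {(k, l). W $ k $ l \<noteq> 0}\<^sup>*"
      using irr by (auto simp: irreducible_matrix_def)
    then show ?thesis
    proof (induction rule: converse_rtrancl_induct)
      case base then show ?case using j0 by (simp add: a_def)
    next
      case (step k l)
      then have "0 < W $ k $ l * a l" using nonneg[of k l] by auto
      also have "\<dots> \<le> (\<Sum>l\<in>UNIV. W $ k $ l * a l)"
        by (rule member_le_sum) (auto simp: a_def nonneg)
      finally show ?case by (simp add: Wa)
    qed
  qed
  define s where "s = sum a UNIV"
  have s: "s > 0" using pos by (auto simp: s_def intro: sum_pos)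
  let ?p = "\<chi> i. a i / s"
  have "sum (($) ?p) UNIV = 1"
    using s by (simp add: sum_divide_distrib[symmetric] s_def[symmetric])
  moreover have "W *v ?p = ?p"
    by (simp add: matrix_vector_mult_def vec_eq_iff sum_divide_distrib[symmetric] Wa)
  ultimately show ?thesis using pos s by (intro exI[of _ ?p]) auto
qed

text \<open>Here \<open>g\<close> is a coupling whose two marginals are both \<open>p\<close>, so
  after expanding the square both diagonal terms equal the second moment under \<open>p\<close>. It
  is applied to the product coupling, which gives the variance, and to the coupling
  \<open>p j * w k j\<close>, which gives the Dirichlet form.\<close>

lemma sum_sum_square_diff:
  fixes g :: "'n::finite \<Rightarrow> 'n \<Rightarrow> real"
  assumes "\<And>j. (\<Sum>k\<in>UNIV. g j k) = p j" "\<And>k. (\<Sum>j\<in>UNIV. g j k) = p k"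
  shows "(\<Sum>j\<in>UNIV. \<Sum>k\<in>UNIV. g j k * (y j - y k)^2)
    = 2 * (\<Sum>j\<in>UNIV. p j * (y j)^2) - 2 * (\<Sum>j\<in>UNIV. \<Sum>k\<in>UNIV. g j k * (y j * y k))"
proof -
  have "(\<Sum>j\<in>UNIV. \<Sum>k\<in>UNIV. g j k * (y j - y k)^2)
    = (\<Sum>j\<in>UNIV. \<Sum>k\<in>UNIV. g j k * (y j)^2) + (\<Sum>j\<in>UNIV. \<Sum>k\<in>UNIV. g j k * (y k)^2)
      - 2 * (\<Sum>j\<in>UNIV. \<Sum>k\<in>UNIV. g j k * (y j * y k))"
    by (simp add: power2_eq_square algebra_simps sum.distrib sum_subtractf sum_distrib_left)
  moreover have "(\<Sum>j\<in>UNIV. \<Sum>k\<in>UNIV. g j k * (y j)^2) = (\<Sum>j\<in>UNIV. p j * (y j)^2)"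
    by (simp add: sum_distrib_right[symmetric] assms)
  moreover have "(\<Sum>j\<in>UNIV. \<Sum>k\<in>UNIV. g j k * (y k)^2) = (\<Sum>j\<in>UNIV. p j * (y j)^2)"
    by (subst sum.swap) (simp add: sum_distrib_right[symmetric] assms)
  ultimately show ?thesis by simp
qed

text \<open>An edge contributes one summand to the Dirichlet form, which bounds the squared
  difference across that edge; a path is handled edge by edge with
  \<open>(a + b)^2 \<le> 2 * a^2 + 2 * b^2\<close>. The constant depends on the path but not on
  \<open>y\<close>. Edges are read off \<open>g l k\<close> with swapped indices because
  \<open>g j k\<close> will be \<open>p j * w k j\<close>, so that \<open>(k, l)\<close> is an edge
  of \<open>w\<close>.\<close>

lemma square_diff_le_dirichlet:
  fixes g :: "'n::finite \<Rightarrow> 'n \<Rightarrow> real"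
  assumes g: "\<And>j k. 0 \<le> g j k" and ij: "(i, j) \<in> {(k, l). g l k \<noteq> 0}\<^sup>*"
  shows "\<exists>C\<ge>0. \<forall>y. (y i - y j)^2 \<le> C * (\<Sum>j\<in>UNIV. \<Sum>k\<in>UNIV. g j k * (y j - y k)^2)"
  using ij
proof (induction rule: converse_rtrancl_induct)
  case base show ?case by (intro exI[of _ 0]) auto
next
  case (step k l)
  then obtain C where C: "C \<ge> 0"
    "\<And>y. (y l - y j)^2 \<le> C * (\<Sum>j\<in>UNIV. \<Sum>k\<in>UNIV. g j k * (y j - y k)^2)" by auto
  from step have gp: "g l k > 0" using g[of l k] by auto
  show ?case
  proof (intro exI[of _ "2 * (1 / g l k) + 2 * C"] conjI allI)
    show "0 \<le> 2 * (1 / g l k) + 2 * C" using C gp by auto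
    fix y :: "'n \<Rightarrow> real"
    let ?E = "\<Sum>j\<in>UNIV. \<Sum>k\<in>UNIV. g j k * (y j - y k)^2"
    have "g l k * (y l - y k)^2 \<le> (\<Sum>k\<in>UNIV. g l k * (y l - y k)^2)"
      by (rule member_le_sum) (auto simp: g)
    also have "\<dots> \<le> ?E"
      by (rule member_le_sum) (auto simp: g intro: sum_nonneg)
    finally have "(y l - y k)^2 \<le> (1 / g l k) * ?E" using gp by (simp add: field_simps)
    moreover have "(y k - y j)^2 \<le> 2 * (y l - y k)^2 + 2 * (y l - y j)^2"
    proof -
      have "0 \<le> ((y l - y k) + (y l - y j))^2" by simp
      then show ?thesis by (simp add: power2_eq_square algebra_simps)
    qed
    ultimately have "(y k - y j)^2 \<le> 2 * ((1 / g l k) * ?E) + 2 * (C * ?E)"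
      using C(2)[of y] by linarith
    also have "\<dots> = (2 * (1 / g l k) + 2 * C) * ?E" by (simp only: distrib_right mult.assoc)
    finally show "(y k - y j)^2 \<le> (2 * (1 / g l k) + 2 * C) * ?E" .
  qed
qed

text \<open>For a function of mean zero, the second moment is half the average of
  \<open>(y i - y j)^2\<close> over independent pairs, so averaging the pairwise path bounds gives
  the spectral gap.\<close>

lemma dirichlet_poincare:
  fixes g :: "'n::finite \<Rightarrow> 'n \<Rightarrow> real"
  assumes g: "\<And>j k. 0 \<le> g j k" and irr: "\<And>i j. (i, j) \<in> {(k, l). g l k \<noteq> 0}\<^sup>*"
    and p: "\<And>i. 0 \<le> p i" "(\<Sum>i\<in>UNIV. p i) = 1"
  shows "\<exists>\<kappa>>0. \<forall>y. (\<Sum>i\<in>UNIV. p i * y i) = 0 \<longrightarrow>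
    \<kappa> * (\<Sum>i\<in>UNIV. p i * (y i)^2) \<le> (\<Sum>j\<in>UNIV. \<Sum>k\<in>UNIV. g j k * (y j - y k)^2)"
proof -
  have "\<exists>C. C \<ge> 0 \<and> (\<forall>y. (y i - y j)^2 \<le> C * (\<Sum>j\<in>UNIV. \<Sum>k\<in>UNIV. g j k * (y j - y k)^2))" for i j
    using square_diff_le_dirichlet[OF g irr] .
  then have "\<forall>i j. \<exists>C. C \<ge> 0 \<and> (\<forall>y. (y i - y j)^2 \<le> C * (\<Sum>j\<in>UNIV. \<Sum>k\<in>UNIV. g j k * (y j - y k)^2))"
    by (intro allI)
  then obtain C where "\<forall>i j. C i j \<ge> (0::real) \<and>
    (\<forall>y. (y i - y j)^2 \<le> C i j * (\<Sum>j\<in>UNIV. \<Sum>k\<in>UNIV. g j k * (y j - y k)^2))"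
    unfolding choice_iff by (elim exE)
  then have C: "\<And>i j. C i j \<ge> 0"
    "\<And>i j y. (y i - y j)^2 \<le> C i j * (\<Sum>j\<in>UNIV. \<Sum>k\<in>UNIV. g j k * (y j - y k)^2)"
    by blast+
  \<comment> \<open>The summand 1 keeps \<open>K\<close> positive even if all constants
    \<open>C i j\<close> are 0, as may happen on a one-point index set.\<close>
  define K where "K = 1 + (\<Sum>i\<in>UNIV. \<Sum>j\<in>UNIV. p i * p j * C i j)"
  have K: "K > 0"
    unfolding K_def by (intro add_pos_nonneg sum_nonneg mult_nonneg_nonneg C p) auto
  show ?thesis
  proof (intro exI[of _ "1 / K"] conjI allI impI)
    show "1 / K > 0" using K by simp
    fix y :: "'n \<Rightarrow> real" assume y: "(\<Sum>i\<in>UNIV. p i * y i) = 0"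
    let ?E = "\<Sum>j\<in>UNIV. \<Sum>k\<in>UNIV. g j k * (y j - y k)^2"
    let ?q = "\<Sum>i\<in>UNIV. p i * (y i)^2"
    have E: "?E \<ge> 0" by (intro sum_nonneg mult_nonneg_nonneg g) auto
    have q: "?q \<ge> 0" by (intro sum_nonneg mult_nonneg_nonneg p) auto
    have "(\<Sum>i\<in>UNIV. \<Sum>j\<in>UNIV. (p i * p j) * (y i * y j)) = (\<Sum>i\<in>UNIV. p i * y i) * (\<Sum>j\<in>UNIV. p j * y j)"
      by (simp add: sum_product mult_ac)
    also have "\<dots> = 0" by (simp add: y)
    finally have cross: "(\<Sum>i\<in>UNIV. \<Sum>j\<in>UNIV. (p i * p j) * (y i * y j)) = 0" .
    have "(\<Sum>j\<in>UNIV. p i * p j) = p i" "(\<Sum>i\<in>UNIV. p i * p j) = p j" for i j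
      by (simp_all only: sum_distrib_left[symmetric] sum_distrib_right[symmetric] p(2) mult_1_left mult_1_right)
    then have "2 * ?q = (\<Sum>i\<in>UNIV. \<Sum>j\<in>UNIV. (p i * p j) * (y i - y j)^2)"
      using sum_sum_square_diff[of "\<lambda>i j. p i * p j" p y] unfolding cross by simp
    also have "\<dots> \<le> (\<Sum>i\<in>UNIV. \<Sum>j\<in>UNIV. (p i * p j) * (C i j * ?E))"
      by (intro sum_mono mult_left_mono C mult_nonneg_nonneg p)
    also have "\<dots> = (K - 1) * ?E"
      unfolding K_def by (simp add: sum_distrib_right mult.assoc)
    also have "\<dots> \<le> K * ?E" using E by (intro mult_right_mono) auto
    finally have "?q \<le> K * ?E" using q by linarith
    then show "1 / K * ?q \<le> ?E" using K by (simp add: field_simps)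
  qed
qed

subsection \<open>Consensus along a single path\<close>

text \<open>Once \<open>\<delta> n < \<kappa> * (e/2)\<close>, the excess of \<open>a\<close> over
  \<open>e/2\<close> shrinks in each step by the factor \<open>1 - \<kappa> * r n\<close>, which is
  at most \<open>exp (- \<kappa> * r n)\<close>. The product of these factors tends to 0 because the
  sum of \<open>r\<close> diverges.\<close>

lemma contraction_recursion_tendsto_0:
  fixes a r \<delta> :: "nat \<Rightarrow> real"
  assumes step: "\<And>n. a (Suc n) \<le> (1 - \<kappa> * r n) * a n + r n * \<delta> n"
    and a: "\<And>n. 0 \<le> a n" and r: "\<And>n. 0 \<le> r n" and lam: "0 < \<kappa>"
    and r0: "r \<longlonglongrightarrow> 0" and rsum: "\<not> summable r" and del: "\<delta> \<longlonglongrightarrow> 0"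
  shows "a \<longlonglongrightarrow> 0"
proof (rule LIMSEQ_I)
  fix e :: real assume e: "0 < e"
  have "eventually (\<lambda>n. \<kappa> * r n < 1) sequentially"
  proof -
    have "(\<lambda>n. \<kappa> * r n) \<longlonglongrightarrow> 0" using tendsto_mult_left[OF r0, of \<kappa>] by simp
    then show ?thesis by (rule order_tendstoD) simp
  qed
  moreover have "eventually (\<lambda>n. \<delta> n < \<kappa> * (e/2)) sequentially"
    using del by (rule order_tendstoD) (use lam e in auto)
  ultimately have "eventually (\<lambda>n. \<kappa> * r n < 1 \<and> \<delta> n < \<kappa> * (e/2)) sequentially"
    by (rule eventually_conj)
  then obtain N where N: "\<And>n. n \<ge> N \<Longrightarrow> \<kappa> * r n < 1 \<and> \<delta> n < \<kappa> * (e/2)"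
    unfolding eventually_sequentially by blast
  \<comment> \<open>At the level \<open>e/2\<close> the contraction absorbs the error term.
    Truncation at 0 keeps \<open>b\<close> nonnegative, so that the factor may be replaced by the
    larger exponential.\<close>
  define b where "b n = max 0 (a n - e/2)" for n
  have b_step: "b (Suc n) \<le> exp (- \<kappa> * r n) * b n" if n: "n \<ge> N" for n
  proof -
    have "a (Suc n) - e/2 \<le> (1 - \<kappa> * r n) * a n + r n * (\<kappa> * (e/2)) - e/2"
      using step[of n] mult_left_mono[of "\<delta> n" "\<kappa> * (e/2)" "r n"] r[of n] N[OF n] by linarith
    also have "\<dots> = (1 - \<kappa> * r n) * (a n - e/2)" by (simp add: algebra_simps)
    also have "\<dots> \<le> (1 - \<kappa> * r n) * b n"
      using N[OF n] by (intro mult_left_mono) (auto simp: b_def)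
    also have "\<dots> \<le> exp (- \<kappa> * r n) * b n"
      using exp_ge_add_one_self[of "- \<kappa> * r n"] by (intro mult_right_mono) (auto simp: b_def)
    finally show ?thesis by (auto simp: b_def)
  qed
  have b_bound: "b (N + n) \<le> exp (- \<kappa> * (\<Sum>k<n. r (N + k))) * b N" for n
  proof (induction n)
    case (Suc n)
    have "b (N + Suc n) \<le> exp (- \<kappa> * r (N + n)) * b (N + n)" using b_step[of "N + n"] by simp
    also have "\<dots> \<le> exp (- \<kappa> * r (N + n)) * (exp (- \<kappa> * (\<Sum>k<n. r (N + k))) * b N)"
      using Suc by (intro mult_left_mono) auto
    also have "\<dots> = exp (- \<kappa> * (\<Sum>k<Suc n. r (N + k))) * b N"
      by (simp add: exp_add[symmetric] algebra_simps)
    finally show ?case .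
  qed simp
  have "\<not> summable (\<lambda>k. r (N + k))"
    using rsum summable_iff_shift[of r N] by (simp add: add.commute)
  then have "filterlim (\<lambda>n. \<Sum>k<n. r (N + k)) at_top sequentially"
    unfolding filterlim_at_top eventually_sequentially
  proof (intro allI)
    fix C :: real
    assume ns: "\<not> summable (\<lambda>k. r (N + k))"
    have "\<exists>n. \<not> (\<Sum>k<n. r (N + k)) \<le> C"
      using ns summableI_nonneg_bounded[of "\<lambda>k. r (N + k)" C] r by auto
    then obtain n where n: "C \<le> (\<Sum>k<n. r (N + k))" by (meson linear)
    have "(\<Sum>k<n. r (N + k)) \<le> (\<Sum>k<m. r (N + k))" if "m \<ge> n" for m
      using that r by (intro sum_mono2) auto
    with n show "\<exists>n. \<forall>m\<ge>n. C \<le> (\<Sum>k<m. r (N + k))" by (meson order_trans)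
  qed
  then have "filterlim (\<lambda>n. - \<kappa> * (\<Sum>k<n. r (N + k))) at_bot sequentially"
    using lam by (intro filterlim_tendsto_neg_mult_at_bot[OF tendsto_const]) auto
  from tendsto_mult[OF filterlim_compose[OF exp_at_bot this] tendsto_const, of "b N"]
  have "(\<lambda>n. exp (- \<kappa> * (\<Sum>k<n. r (N + k))) * b N) \<longlonglongrightarrow> 0"
    by simp
  then have "(\<lambda>n. b (N + n)) \<longlonglongrightarrow> 0"
    by (rule Lim_null_comparison[rotated])
      (use b_bound in \<open>auto simp: b_def intro!: always_eventually\<close>)
  then have "b \<longlonglongrightarrow> 0"
    by (intro LIMSEQ_offset[of b N]) (simp only: add.commute[of _ N])
  then have ev: "eventually (\<lambda>n. b n < e/2) sequentially"
    by (rule order_tendstoD) (use e in auto)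
  have "norm (a n - 0) < e" if "b n < e/2" for n
  proof -
    have "a n - e/2 \<le> b n" by (simp add: b_def)
    then show ?thesis using that a[of n] by simp
  qed
  from ev this show "\<exists>no. \<forall>n\<ge>no. norm (a n - 0) < e"
    unfolding eventually_sequentially[symmetric] by (rule eventually_mono)
qed

text \<open>This is the deterministic part: \<open>D\<close> stands for the noise along one path,
  and only the convergence of its series is used. The weights \<open>p\<close> form the Perron
  vector of \<open>w\<close>.\<close>

lemma stochastic_approximation_consensus:
  fixes w :: "'n::finite \<Rightarrow> 'n \<Rightarrow> real" and z D :: "nat \<Rightarrow> 'n \<Rightarrow> real"
  assumes w: "\<And>k j. 0 \<le> w k j" "\<And>j. (\<Sum>k\<in>UNIV. w k j) = 1"
    and irr: "\<And>i j. (i, j) \<in> {(k, l). w k l \<noteq> 0}\<^sup>*"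
    and p: "\<And>i. 0 < p i" "(\<Sum>i\<in>UNIV. p i) = 1" "\<And>k. (\<Sum>j\<in>UNIV. w k j * p j) = p k"
    and r: "\<And>n. 0 \<le> r n" "r \<longlonglongrightarrow> 0" "\<not> summable r"
    and step: "\<And>n j. z (Suc n) j = z n j + r n * ((\<Sum>k\<in>UNIV. w k j * z n k) - z n j) + D n j"
    and D: "\<And>j. summable (\<lambda>n. D n j)"
    and z: "\<And>n j. z n j \<in> {0..1}"
  shows "\<exists>L. \<forall>j. (\<lambda>n. z n j) \<longlonglongrightarrow> L"
proof -
  \<comment> \<open>\<open>B\<close> is the drift, the transpose of \<open>w\<close> minus the
    identity; \<open>m\<close> is the \<open>p\<close>-mean, \<open>q\<close> the squared
    \<open>p\<close>-weighted norm, and \<open>E\<close> the Dirichlet form.\<close>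
  define B where "B x j = (\<Sum>k\<in>UNIV. w k j * x k) - x j" for x :: "'n \<Rightarrow> real" and j
  define m where "m x = (\<Sum>i\<in>UNIV. p i * x i)" for x :: "'n \<Rightarrow> real"
  define q where "q x = (\<Sum>i\<in>UNIV. p i * (x i)^2)" for x :: "'n \<Rightarrow> real"
  define E where "E x = (\<Sum>j\<in>UNIV. \<Sum>k\<in>UNIV. p j * w k j * (x j - x k)^2)" for x :: "'n \<Rightarrow> real"
  have m_B: "m (B x) = 0" for x
  proof -
    have "(\<Sum>j\<in>UNIV. p j * (\<Sum>k\<in>UNIV. w k j * x k)) = (\<Sum>k\<in>UNIV. \<Sum>j\<in>UNIV. w k j * p j * x k)"
      by (subst sum.swap) (simp add: sum_distrib_left mult_ac)
    also have "\<dots> = m x" by (simp add: sum_distrib_right[symmetric] p m_def)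
    finally show ?thesis by (simp add: m_def B_def right_diff_distrib sum_subtractf)
  qed
  have m_add: "m (\<lambda>j. x j + y j) = m x + m y" for x y
    by (simp add: m_def distrib_left sum.distrib)
  have m_diff: "m (\<lambda>j. x j - y j) = m x - m y" for x y
    by (simp add: m_def right_diff_distrib sum_subtractf)
  have m_const: "m (\<lambda>j. c) = c" for c
    by (simp add: m_def sum_distrib_right[symmetric] p)
  have m_scale: "m (\<lambda>j. c * x j) = c * m x" for x c
    by (simp add: m_def sum_distrib_left mult_ac)
  have B_diff: "B (\<lambda>j. x j - y j) j = B x j - B y j" for x y j
    by (simp add: B_def right_diff_distrib sum_subtractf)
  have B_const: "B (\<lambda>j. c) j = 0" for c j
    by (simp add: B_def sum_distrib_right[symmetric] w)
  have q_nonneg: "0 \<le> q x" for x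
    unfolding q_def using p(1) by (intro sum_nonneg mult_nonneg_nonneg) (auto intro: less_imp_le)
  \<comment> \<open>The weights \<open>p j * w k j\<close> have both marginals equal to
    \<open>p\<close>: one by the column sums of \<open>w\<close>, the other by the Perron equation.
    Hence the drift dissipates \<open>q\<close> at exactly the rate \<open>E\<close>.\<close>
  have dissipation: "2 * m (\<lambda>j. y j * B y j) = - E y" for y
  proof -
    have "E y = 2 * q y - 2 * (\<Sum>j\<in>UNIV. \<Sum>k\<in>UNIV. p j * w k j * (y j * y k))"
      unfolding E_def q_def
    proof (rule sum_sum_square_diff)
      show "(\<Sum>k\<in>UNIV. p j * w k j) = p j" for j
        by (simp add: sum_distrib_left[symmetric] w)
      show "(\<Sum>j\<in>UNIV. p j * w k j) = p k" for k
        using p(3)[of k] by (simp add: mult.commute)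
    qed
    also have "(\<Sum>j\<in>UNIV. \<Sum>k\<in>UNIV. p j * w k j * (y j * y k)) = m (\<lambda>j. y j * B y j) + q y"
      by (simp add: m_def q_def B_def power2_eq_square algebra_simps sum_subtractf sum_distrib_left)
    finally show ?thesis by simp
  qed
  have "(i, j) \<in> {(k, l). p l * w k l \<noteq> 0}\<^sup>*" for i j
  proof -
    have "p l \<noteq> 0" for l using p(1)[of l] by simp
    then show ?thesis using irr by simp
  qed
  then obtain \<kappa> where kap: "\<kappa> > 0" and poincare: "\<And>y. m y = 0 \<Longrightarrow> \<kappa> * q y \<le> E y"
    using dirichlet_poincare[of "\<lambda>j k. p j * w k j" p] p w
    unfolding m_def q_def E_def by (auto simp: less_imp_le)
  \<comment> \<open>The noise is centred so that its tails \<open>s n\<close> have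
    \<open>p\<close>-mean zero; the corrected deviation \<open>y\<close> then has mean zero too, as
    the Poincare inequality requires.\<close>
  define D' where "D' n j = D n j - m (D n)" for n j
  have D': "summable (\<lambda>n. D' n j)" for j
    unfolding D'_def m_def by (intro summable_diff summable_sum summable_mult D)
  have mD': "m (D' n) = 0" for n
    unfolding D'_def by (simp add: m_diff m_const)
  define s where "s n j = (\<Sum>i. D' (i + n) j)" for n j
  have s_lim: "(\<lambda>n. s n j) \<longlonglongrightarrow> 0" for j
    unfolding s_def using suminf_exist_split2[OF D'] .
  have s_step: "s n j = D' n j + s (Suc n) j" for n j
    using suminf_split_head[OF summable_ignore_initial_segment[OF D', of n]] by (simp add: s_def)
  have s_mean: "m (s n) = 0" for n
  proof -
    have "m (s n) = (\<Sum>j\<in>UNIV. \<Sum>i. p j * D' (i + n) j)"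
      unfolding m_def s_def
      using summable_ignore_initial_segment[OF D', of n] by (simp add: suminf_mult)
    also have "\<dots> = (\<Sum>i. m (D' (i + n)))"
      unfolding m_def
      by (intro suminf_sum[symmetric] summable_mult summable_ignore_initial_segment[OF D'])
    finally show ?thesis by (simp add: mD')
  qed
  define u where "u n j = z n j - m (z n)" for n j
  \<comment> \<open>Adding the tail of the noise series cancels the noise: \<open>s n\<close> loses
    exactly the term \<open>D' n\<close> that the deviation gains, so \<open>y\<close> moves by the
    drift alone.\<close>
  define y where "y n j = u n j + s n j" for n j
  have z_step: "z (Suc n) = (\<lambda>j. z n j + r n * B (z n) j + D n j)" for n
    by (auto simp: step B_def)
  have m_step: "m (z (Suc n)) = m (z n) + m (D n)" for n
    unfolding z_step by (simp add: m_add m_scale m_B)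
  have y_step: "y (Suc n) j = y n j + r n * B (z n) j" for n j
    unfolding y_def u_def m_step s_step[of n j] by (simp add: z_step D'_def)
  have m_y: "m (y n) = 0" for n
    unfolding y_def u_def by (simp add: m_add m_diff m_const s_mean)
  have B_z: "B (z n) j = B (y n) j - B (s n) j" for n j
  proof -
    \<comment> \<open>\<open>z n\<close> is \<open>y n - s n\<close> shifted by the constant
      \<open>m (z n)\<close>, and \<open>B\<close> annihilates constants.\<close>
    have "B (z n) j = B (\<lambda>j. (y n j - s n j) - (- m (z n))) j"
      by (rule arg_cong[of _ _ "\<lambda>x. B x j"]) (auto simp: y_def u_def)
    then show ?thesis unfolding B_diff B_const by simp
  qed
  \<comment> \<open>The error collects the second-order term of the step and the effect of replacing
    \<open>B (z n)\<close> by \<open>B (y n)\<close>. The first vanishes with \<open>r\<close>, the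
    second with the tails \<open>s n\<close>.\<close>
  define \<delta> where "\<delta> n = r n * q (B (z n)) - 2 * m (\<lambda>j. y n j * B (s n) j)" for n
  have q_step: "q (y (Suc n)) \<le> (1 - \<kappa> * r n) * q (y n) + r n * \<delta> n" for n
  proof -
    have "q (y (Suc n)) = q (y n) + 2 * r n * m (\<lambda>j. y n j * B (z n) j) + (r n)^2 * q (B (z n))"
      unfolding q_def m_def y_step
      by (simp add: power2_eq_square algebra_simps sum.distrib sum_distrib_left)
    also have "m (\<lambda>j. y n j * B (z n) j) = m (\<lambda>j. y n j * B (y n) j) - m (\<lambda>j. y n j * B (s n) j)"
      unfolding B_z by (simp add: right_diff_distrib m_diff)
    also have "q (y n) + 2 * r n * (m (\<lambda>j. y n j * B (y n) j) - m (\<lambda>j. y n j * B (s n) j))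
        + (r n)^2 * q (B (z n)) = q (y n) + r n * (2 * m (\<lambda>j. y n j * B (y n) j)) + r n * \<delta> n"
      by (simp add: \<delta>_def power2_eq_square algebra_simps)
    also have "\<dots> = q (y n) - r n * E (y n) + r n * \<delta> n"
      unfolding dissipation by simp
    also have "\<dots> \<le> q (y n) - r n * (\<kappa> * q (y n)) + r n * \<delta> n"
      using mult_left_mono[OF poincare[OF m_y] r(1)[of n]] by simp
    finally show ?thesis by (simp add: algebra_simps)
  qed
  have wz: "(\<Sum>k\<in>UNIV. w k j * z n k) \<in> {0..1}" for n j
  proof -
    have "(\<Sum>k\<in>UNIV. w k j * z n k) \<le> (\<Sum>k\<in>UNIV. w k j * 1)"
      using z w by (intro sum_mono mult_left_mono) auto
    then show ?thesis using z w by (auto intro!: sum_nonneg)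
  qed
  have q_Bz: "q (B (z n)) \<le> 1" for n
  proof -
    have "(B (z n) j)^2 \<le> 1" for j
      using wz[of j n] z[of n j] unfolding B_def abs_square_le_1 by auto
    then have "q (B (z n)) \<le> (\<Sum>i\<in>UNIV. p i * 1)"
      unfolding q_def using p(1) by (intro sum_mono mult_left_mono) (auto intro: less_imp_le)
    then show ?thesis by (simp add: p)
  qed
  have m_z: "m (z n) \<in> {0..1}" for n
  proof -
    have "m (z n) \<le> (\<Sum>k\<in>UNIV. p k * 1)"
      unfolding m_def using z p by (intro sum_mono mult_left_mono) (auto intro: less_imp_le)
    then show ?thesis using z p by (auto simp: m_def less_imp_le intro!: sum_nonneg mult_nonneg_nonneg)
  qed
  have u_bound: "norm (u n j) \<le> 1" for n j
    using m_z[of n] z[of n j] by (auto simp: u_def)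
  have Bs_lim: "(\<lambda>n. B (s n) j) \<longlonglongrightarrow> 0" for j
    unfolding B_def by (auto intro!: tendsto_eq_intros s_lim)
  \<comment> \<open>No bound on \<open>y\<close> is needed: it splits into \<open>u\<close>, which
    is bounded by 1, and \<open>s\<close>, which tends to 0. The limit is spelled out in the shape
    that this splitting produces.\<close>
  have "(\<lambda>n. m (\<lambda>j. y n j * B (s n) j)) \<longlonglongrightarrow> (\<Sum>i\<in>UNIV. p i * (0 + 0 * 0))"
    unfolding m_def y_def distrib_right
  proof (intro tendsto_sum tendsto_mult tendsto_const tendsto_add s_lim Bs_lim)
    fix j show "(\<lambda>n. u n j * B (s n) j) \<longlonglongrightarrow> 0"
      by (rule lim_null_mult_left_bounded[OF _ Bs_lim, of _ 1]) (intro always_eventually allI u_bound)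
  qed
  moreover have "(\<lambda>n. r n * q (B (z n))) \<longlonglongrightarrow> 0"
    by (rule lim_null_mult_right_bounded[OF r(2), of _ 1]) (auto simp: q_Bz q_nonneg)
  ultimately have "\<delta> \<longlonglongrightarrow> 0 - 2 * 0"
    unfolding \<delta>_def by (intro tendsto_intros) simp_all
  then have "(\<lambda>n. q (y n)) \<longlonglongrightarrow> 0"
    using contraction_recursion_tendsto_0[of "\<lambda>n. q (y n)" \<kappa> r \<delta>] q_step q_nonneg r kap by simp
  have y_lim: "(\<lambda>n. y n j) \<longlonglongrightarrow> 0" for j
  proof -
    have le: "p j * (y n j)^2 \<le> q (y n)" for n
      unfolding q_def
      by (rule member_le_sum) (use p(1) in \<open>auto intro!: mult_nonneg_nonneg intro: less_imp_le\<close>)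
    have "norm ((y n j)^2) \<le> q (y n) / p j" for n
      using le[of n] p(1)[of j] by (simp add: pos_le_divide_eq mult.commute)
    moreover have "(\<lambda>n. q (y n) / p j) \<longlonglongrightarrow> 0"
      using tendsto_divide[OF \<open>(\<lambda>n. q (y n)) \<longlonglongrightarrow> 0\<close> tendsto_const, of "p j"] p(1)[of j] by simp
    ultimately have "(\<lambda>n. (y n j)^2) \<longlonglongrightarrow> 0"
      by (rule Lim_null_comparison[OF always_eventually[OF allI]])
    from tendsto_real_sqrt[OF this] show ?thesis
      by (simp add: tendsto_rabs_zero_iff)
  qed
  have u_lim: "(\<lambda>n. u n j) \<longlonglongrightarrow> 0" for j
    using tendsto_diff[OF y_lim s_lim, of j j] by (simp add: y_def)
  \<comment> \<open>The drift has \<open>p\<close>-mean zero, so the mean is a partial sum of the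
    averaged noise; its limit is the common limit \<open>L\<close>.\<close>
  have "m (z n) = m (z 0) + (\<Sum>k<n. m (D k))" for n
    by (induction n) (auto simp: m_step)
  then have m_sum: "(\<lambda>n. m (z n)) = (\<lambda>n. m (z 0) + (\<Sum>k<n. m (D k)))"
    by (rule ext)
  have "summable (\<lambda>n. m (D n))"
    unfolding m_def by (intro summable_sum summable_mult D)
  then have "(\<lambda>n. m (z n)) \<longlonglongrightarrow> m (z 0) + (\<Sum>k. m (D k))"
    unfolding m_sum by (intro tendsto_add tendsto_const summable_LIMSEQ)
  from tendsto_add[OF u_lim this] show ?thesis by (auto simp: u_def)
qed

subsection \<open>Convergence of martingales with square-summable increments\<close>

text \<open>The martingale property enters as \<open>orth\<close>, orthogonality to bounded
  functions of the past. This removes the cross terms from the second moment, so each step adds at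
  most \<open>(d n)^2\<close>.\<close>

lemma (in prob_space) martingale_differences_maximal_inequality:
  fixes D :: "nat \<Rightarrow> 'a \<Rightarrow> real"
  assumes sub: "\<And>n. subalgebra M (F n)" and mono: "\<And>n. sets (F n) \<subseteq> sets (F (Suc n))"
    and D_meas: "\<And>n. D n \<in> borel_measurable (F (Suc n))"
    and D_bound: "\<And>n \<omega>. \<omega> \<in> space M \<Longrightarrow> \<bar>D n \<omega>\<bar> \<le> d n"
    and orth: "\<And>n G C. G \<in> borel_measurable (F n) \<Longrightarrow> (\<And>\<omega>. \<omega> \<in> space M \<Longrightarrow> \<bar>G \<omega>\<bar> \<le> C) \<Longrightarrow>
      expectation (\<lambda>\<omega>. G \<omega> * D n \<omega>) = 0"
    and e: "0 < e"
  shows "prob {\<omega> \<in> space M. \<exists>j\<le>n. e < \<bar>\<Sum>k<j. D k \<omega>\<bar>} \<le> (\<Sum>k<n. (d k)^2) / e^2"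
proof -
  \<comment> \<open>The partial sums, frozen once they leave \<open>[-e, e]\<close>: Chebyshev for the terminal value of this
    martingale controls the whole path.\<close>
  define T where "T = rec_nat (\<lambda>\<omega>. 0) (\<lambda>n t \<omega>. t \<omega> + (if \<bar>t \<omega>\<bar> \<le> e then D n \<omega> else 0))"
  have T0: "T 0 \<omega> = 0"
    and TSuc: "T (Suc n) \<omega> = T n \<omega> + (if \<bar>T n \<omega>\<bar> \<le> e then D n \<omega> else 0)" for n \<omega>
    by (simp_all add: T_def)
  have space_F: "space (F n) = space M" for n using sub by (simp add: subalgebra_def)
  have subF: "subalgebra (F (Suc n)) (F n)" for n
    using mono by (simp add: subalgebra_def space_F)
  have T_F: "T n \<in> borel_measurable (F n)" for n
  proof (induction n)
    case (Suc n)
    have [measurable]: "T n \<in> borel_measurable (F (Suc n))" "D n \<in> borel_measurable (F (Suc n))"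
      using measurable_from_subalg[OF subF Suc] D_meas by auto
    have "T (Suc n) = (\<lambda>\<omega>. T n \<omega> + (if \<bar>T n \<omega>\<bar> \<le> e then D n \<omega> else 0))"
      by (auto simp: TSuc)
    then show ?case by simp
  qed (simp add: T0)
  have T_M[measurable]: "T n \<in> borel_measurable M" for n
    using measurable_from_subalg[OF sub T_F] .
  have D_M[measurable]: "D n \<in> borel_measurable M" for n
    using measurable_from_subalg[OF sub D_meas] .
  have T_bound: "\<bar>T n \<omega>\<bar> \<le> (\<Sum>k<n. d k)" if "\<omega> \<in> space M" for n \<omega>
  proof (induction n)
    case (Suc n) then show ?case using D_bound[OF that, of n] by (auto simp: TSuc)
  qed (simp add: T0)
  have int: "integrable M f" if "f \<in> borel_measurable M" "\<And>\<omega>. \<omega> \<in> space M \<Longrightarrow> \<bar>f \<omega>\<bar> \<le> C" for f :: "'a \<Rightarrow> real" and C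
    using that by (intro integrable_const_bound[of _ C]) auto
  have T2_int: "integrable M (\<lambda>\<omega>. (T n \<omega>)^2)" for n
    using power_mono[OF T_bound, of _ n 2] by (intro int[of _ "(\<Sum>k<n. d k)^2"]) simp_all
  have T2: "expectation (\<lambda>\<omega>. (T n \<omega>)^2) \<le> (\<Sum>k<n. (d k)^2)" for n
  proof (induction n)
    case (Suc n)
    \<comment> \<open>\<open>G\<close> is the coefficient of \<open>D n\<close> in the expanded
      square. The freezing condition bounds it by \<open>2 * e\<close> and depends on the past only,
      so \<open>orth\<close> applies.\<close>
    define G where "G \<omega> = (if \<bar>T n \<omega>\<bar> \<le> e then 2 * T n \<omega> else 0)" for \<omega>
    have G: "G \<in> borel_measurable (F n)" "\<bar>G \<omega>\<bar> \<le> 2 * e" for \<omega>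
      using T_F[of n] e unfolding G_def by auto
    have [measurable]: "G \<in> borel_measurable M" using measurable_from_subalg[OF sub G(1)] .
    have GD: "integrable M (\<lambda>\<omega>. G \<omega> * D n \<omega>)"
    proof (intro int[of _ "2 * e * d n"])
      fix \<omega> assume "\<omega> \<in> space M"
      then show "\<bar>G \<omega> * D n \<omega>\<bar> \<le> 2 * e * d n"
        unfolding abs_mult using G D_bound e by (intro mult_mono) auto
    qed measurable
    have "expectation (\<lambda>\<omega>. (T (Suc n) \<omega>)^2) \<le> expectation (\<lambda>\<omega>. (T n \<omega>)^2 + G \<omega> * D n \<omega> + (d n)^2)"
    proof (intro integral_mono T2_int Bochner_Integration.integrable_add GD)
      fix \<omega> assume om: "\<omega> \<in> space M"
      have "(D n \<omega>)^2 \<le> (d n)^2"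
        using power_mono[OF D_bound[OF om], of n 2] by simp
      then show "(T (Suc n) \<omega>)^2 \<le> (T n \<omega>)^2 + G \<omega> * D n \<omega> + (d n)^2"
        by (simp add: TSuc G_def power2_eq_square algebra_simps)
    qed simp
    also have "\<dots> = expectation (\<lambda>\<omega>. (T n \<omega>)^2) + expectation (\<lambda>\<omega>. G \<omega> * D n \<omega>) + (d n)^2"
      using T2_int GD by (simp add: prob_space)
    also have "expectation (\<lambda>\<omega>. G \<omega> * D n \<omega>) = 0"
      using orth[OF G(1)] G(2) by blast
    finally show ?case using Suc by simp
  qed (simp add: T0)
  \<comment> \<open>A terminal value inside the band means that freezing never occurred:
    \<open>T\<close> agrees with the partial sums and none of them has left the band.\<close>
  have T_eq: "\<bar>T n \<omega>\<bar> \<le> e \<Longrightarrow> T n \<omega> = (\<Sum>k<n. D k \<omega>) \<and> (\<forall>j\<le>n. \<bar>\<Sum>k<j. D k \<omega>\<bar> \<le> e)" for n \<omega>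
  proof (induction n)
    case (Suc n)
    have *: "\<bar>T n \<omega>\<bar> \<le> e" using Suc.prems by (auto simp: TSuc split: if_splits)
    note IH = Suc.IH[OF *]
    have eq: "T (Suc n) \<omega> = (\<Sum>k<Suc n. D k \<omega>)" using * IH by (simp add: TSuc)
    then have "\<bar>\<Sum>k<Suc n. D k \<omega>\<bar> \<le> e" using Suc.prems by metis
    with eq IH show ?case by (metis le_Suc_eq)
  qed (use e in \<open>simp add: T0\<close>)
  have "prob {\<omega> \<in> space M. \<exists>j\<le>n. e < \<bar>\<Sum>k<j. D k \<omega>\<bar>} \<le> prob {\<omega> \<in> space M. e \<le> \<bar>T n \<omega>\<bar>}"
  proof (intro finite_measure_mono subsetI)
    fix \<omega> assume "\<omega> \<in> {\<omega> \<in> space M. \<exists>j\<le>n. e < \<bar>\<Sum>k<j. D k \<omega>\<bar>}"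
    then show "\<omega> \<in> {\<omega> \<in> space M. e \<le> \<bar>T n \<omega>\<bar>}"
      using T_eq[of n \<omega>] by (cases "\<bar>T n \<omega>\<bar> \<le> e") (auto simp: not_le)
  qed simp
  also have "\<dots> \<le> expectation (\<lambda>\<omega>. (T n \<omega>)^2) / e^2"
    using second_moment_method[OF T_M T2_int e] .
  also have "\<dots> \<le> (\<Sum>k<n. (d k)^2) / e^2"
    using T2 by (intro divide_right_mono) auto
  finally show ?thesis .
qed

text \<open>The maximal inequality, applied to the sequence started at \<open>m\<close>, bounds the
  fluctuation after \<open>m\<close> by a tail of the series of \<open>(d n)^2\<close>. Letting
  \<open>m\<close> grow yields the Cauchy criterion almost surely.\<close>

lemma (in prob_space) martingale_differences_AE_summable:
  fixes D :: "nat \<Rightarrow> 'a \<Rightarrow> real"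
  assumes sub: "\<And>n. subalgebra M (F n)" and mono: "\<And>n. sets (F n) \<subseteq> sets (F (Suc n))"
    and D_meas: "\<And>n. D n \<in> borel_measurable (F (Suc n))"
    and D_bound: "\<And>n \<omega>. \<omega> \<in> space M \<Longrightarrow> \<bar>D n \<omega>\<bar> \<le> d n"
    and orth: "\<And>n G C. G \<in> borel_measurable (F n) \<Longrightarrow> (\<And>\<omega>. \<omega> \<in> space M \<Longrightarrow> \<bar>G \<omega>\<bar> \<le> C) \<Longrightarrow>
      expectation (\<lambda>\<omega>. G \<omega> * D n \<omega>) = 0"
    and d: "summable (\<lambda>n. (d n)^2)"
  shows "AE \<omega> in M. summable (\<lambda>n. D n \<omega>)"
proof -
  have D_M[measurable]: "D n \<in> borel_measurable M" for n
    using measurable_from_subalg[OF sub D_meas] .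
  define R where "R m = (\<Sum>k. (d (k + m))^2)" for m
  have R: "R \<longlonglongrightarrow> 0" unfolding R_def using suminf_exist_split2[OF d] .
  define A where "A e m = {\<omega> \<in> space M. \<exists>j. e < \<bar>\<Sum>k<j. D (m + k) \<omega>\<bar>}" for e m
  have A_meas[measurable]: "A e m \<in> sets M" for e m
    unfolding A_def by measurable
  have A_prob: "prob (A e m) \<le> R m / e^2" if e: "e > 0" for e m
  proof -
    \<comment> \<open>The maximal inequality covers finite horizons; these events increase to
      \<open>A e m\<close>, so continuity from below carries the uniform bound over.\<close>
    define A' where "A' n = {\<omega> \<in> space M. \<exists>j\<le>n. e < \<bar>\<Sum>k<j. D (m + k) \<omega>\<bar>}" for n
    have "(\<lambda>n. prob (A' n)) \<longlonglongrightarrow> prob (\<Union>n. A' n)"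
      by (rule finite_Lim_measure_incseq)
        (auto simp: A'_def incseq_def intro: order_trans)
    moreover have "(\<Union>n. A' n) = A e m" by (auto simp: A'_def A_def)
    moreover have "prob (A' n) \<le> R m / e^2" for n
    proof -
      have "prob (A' n) \<le> (\<Sum>k<n. (d (m + k))^2) / e^2"
        unfolding A'_def
      proof (rule martingale_differences_maximal_inequality[where F = "\<lambda>n. F (m + n)"])
        show "expectation (\<lambda>\<omega>. G \<omega> * D (m + n) \<omega>) = 0"
          if "G \<in> borel_measurable (F (m + n))" "\<And>\<omega>. \<omega> \<in> space M \<Longrightarrow> \<bar>G \<omega>\<bar> \<le> C" for G n C
          using orth[of G "m + n" C] that by blast
      qed (use sub mono D_meas D_bound e in auto)
      also have "(\<Sum>k<n. (d (m + k))^2) \<le> R m"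
        unfolding R_def using d
        by (subst add.commute) (auto intro!: sum_le_suminf simp: summable_iff_shift[of "\<lambda>n. (d n)^2" m])
      finally show ?thesis by (simp add: divide_right_mono)
    qed
    ultimately show ?thesis by (intro LIMSEQ_le_const2[of "\<lambda>n. prob (A' n)"]) auto
  qed
  \<comment> \<open>Restricting to the levels \<open>1 / real (Suc i)\<close> leaves countably many
    null sets. Each bad event lies in \<open>A ?e m\<close> for every \<open>m\<close>, and these
    probabilities tend to 0.\<close>
  have "AE \<omega> in M. \<exists>m. \<omega> \<notin> A (1 / real (Suc i)) m" for i
  proof -
    let ?e = "1 / real (Suc i)"
    have "(\<lambda>m. R m / ?e^2) \<longlonglongrightarrow> 0 / ?e^2" by (intro tendsto_divide R) auto
    moreover have "prob (\<Inter>m. A ?e m) \<le> R m / ?e^2" for m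
      by (rule order_trans[OF finite_measure_mono A_prob]) auto
    ultimately have "prob (\<Inter>m. A ?e m) \<le> 0"
      by (intro LIMSEQ_le_const[of "\<lambda>m. R m / ?e^2"]) auto
    then have "(\<Inter>m. A ?e m) \<in> null_sets M"
      by (intro null_setsI) (auto simp: emeasure_eq_measure measure_le_0_iff)
    then show ?thesis by (rule AE_I') auto
  qed
  then have "AE \<omega> in M. \<forall>i. \<exists>m. \<omega> \<notin> A (1 / real (Suc i)) m"
    by (simp add: AE_all_countable)
  with AE_space show ?thesis
  proof eventually_elim
    case (elim \<omega>)
    show ?case unfolding summable_Cauchy
    proof (intro allI impI)
      fix e :: real assume "0 < e"
      then obtain i where i: "1 / real (Suc i) < e / 2"
        using nat_approx_posE[of "e / 2"] by auto
      obtain m where "\<omega> \<notin> A (1 / real (Suc i)) m" using elim by auto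
      then have m: "\<bar>\<Sum>k<j. D (m + k) \<omega>\<bar> < e / 2" for j
        using elim(1) by (intro le_less_trans[OF _ i]) (auto simp: A_def not_less)
      \<comment> \<open>A block from \<open>a\<close> to \<open>b\<close> is the difference of two
        sums started at \<open>m\<close>, each smaller than \<open>e / 2\<close>.\<close>
      have "norm (\<Sum>k=a..<b. D k \<omega>) < e" if "a \<ge> m" for a b
      proof (cases "a \<le> b")
        case True
        have shift: "(\<Sum>k<j. D (m + k) \<omega>) = (\<Sum>k=m..<m+j. D k \<omega>)" for j
          by (induction j) auto
        have "(\<Sum>k=m..<a. D k \<omega>) + (\<Sum>k=a..<b. D k \<omega>) = (\<Sum>k=m..<b. D k \<omega>)"
          using that True by (intro sum.atLeastLessThan_concat) auto
        moreover have "\<bar>\<Sum>k=m..<a. D k \<omega>\<bar> < e / 2" "\<bar>\<Sum>k=m..<b. D k \<omega>\<bar> < e / 2"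
          using m[of "a - m"] m[of "b - m"] that True unfolding shift by auto
        ultimately show ?thesis unfolding real_norm_def by linarith
      qed (use \<open>0 < e\<close> in auto)
      then show "\<exists>N. \<forall>a\<ge>N. \<forall>b. norm (\<Sum>k=a..<b. D k \<omega>) < e" by blast
    qed
  qed
qed

subsection \<open>The reinforced processes\<close>

lemma space_history_algebra: "space (history_algebra M Y X n) = space M"
  by (simp add: history_algebra_def space_measure_of_conv)

lemma sets_history_algebra:
  "sets (history_algebra M Y X n) = sigma_sets (space M)
    ({Y -` A \<inter> space M | A. A \<in> sets borel} \<union>
     {X m -` A \<inter> space M | m A. m \<in> {1..n} \<and> A \<in> sets borel})"
  unfolding history_algebra_def by (rule sets_measure_of) auto

lemma subalgebra_history_algebra:
  assumes "Y \<in> borel_measurable M" "\<And>m. m \<in> {1..n} \<Longrightarrow> X m \<in> borel_measurable M"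
  shows "subalgebra M (history_algebra M Y X n)"
  unfolding subalgebra_def space_history_algebra sets_history_algebra
proof (intro conjI refl sets.sigma_sets_subset Un_least subsetI)
  fix B assume "B \<in> {Y -` A \<inter> space M | A. A \<in> sets borel}"
  then show "B \<in> sets M" using measurable_sets[OF assms(1)] by blast
next
  fix B assume "B \<in> {X m -` A \<inter> space M | m A. m \<in> {1..n} \<and> A \<in> sets borel}"
  then obtain m A where "B = X m -` A \<inter> space M" "m \<in> {1..n}" "A \<in> sets borel" by blast
  then show "B \<in> sets M" using measurable_sets[OF assms(2)] by simp
qed

lemma sets_history_algebra_mono:
  assumes "m \<le> n"
  shows "sets (history_algebra M Y X m) \<subseteq> sets (history_algebra M Y X n)"
proof -
  have "{1..m} \<subseteq> {1..n}" using assms by auto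
  then show ?thesis
    unfolding sets_history_algebra by (intro sigma_sets_mono' Un_mono order_refl) blast
qed

lemma initial_measurable_history_algebra: "Y \<in> borel_measurable (history_algebra M Y X n)"
proof (rule measurableI)
  fix A :: "'b set" assume "A \<in> sets borel"
  then show "Y -` A \<inter> space (history_algebra M Y X n) \<in> sets (history_algebra M Y X n)"
    unfolding space_history_algebra sets_history_algebra
    by (intro sigma_sets.Basic UnI1) blast
qed simp

lemma step_measurable_history_algebra:
  assumes "m \<in> {1..n}"
  shows "X m \<in> borel_measurable (history_algebra M Y X n)"
proof (rule measurableI)
  fix A :: "'b set" assume "A \<in> sets borel"
  with assms show "X m -` A \<inter> space (history_algebra M Y X n) \<in> sets (history_algebra M Y X n)"
    unfolding space_history_algebra sets_history_algebra
    by (intro sigma_sets.Basic UnI2) blast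
qed simp

lemma measurable_cong_history:
  "(\<And>\<omega>. \<omega> \<in> space M \<Longrightarrow> f \<omega> = g \<omega>) \<Longrightarrow>
    f \<in> borel_measurable (history_algebra M Y X n) \<longleftrightarrow> g \<in> borel_measurable (history_algebra M Y X n)"
  by (intro measurable_cong) (simp add: space_history_algebra)

text \<open>Eventually \<open>real n powr \<gamma> * r n\<close> lies between \<open>c / 2\<close>
  and \<open>2 * c\<close>. The squares are then compared with the exponent
  \<open>- 2 * \<gamma> < - 1\<close>, and \<open>r\<close> itself with the harmonic series, using
  \<open>\<gamma> \<le> 1\<close>.\<close>

lemma polynomial_step_size:
  fixes r :: "nat \<Rightarrow> real"
  assumes r: "\<And>n. 0 \<le> r n" and lim: "(\<lambda>n. real n powr \<gamma> * r n) \<longlonglongrightarrow> c"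
    and c: "0 < c" and \<gamma>: "1 / 2 < \<gamma>" "\<gamma> \<le> 1"
  shows "summable (\<lambda>n. (r n)^2)" "\<not> summable r"
proof -
  have "eventually (\<lambda>n. real n powr \<gamma> * r n < 2 * c) sequentially"
    using lim by (rule order_tendstoD) (use c in auto)
  then have "eventually (\<lambda>n. norm ((r n)^2) \<le> 4 * c^2 * real n powr (- 2 * \<gamma>)) sequentially"
    using eventually_gt_at_top[of 0]
  proof eventually_elim
    case (elim n)
    have "r n \<le> 2 * c * real n powr (- \<gamma>)"
      using elim by (simp add: powr_minus field_simps)
    then have "(r n)^2 \<le> (2 * c * real n powr (- \<gamma>))^2"
      using r by (intro power_mono) auto
    also have "\<dots> = 4 * c^2 * real n powr (- 2 * \<gamma>)"
      by (simp add: power_mult_distrib power2_eq_square powr_add[symmetric])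
    finally show ?case by simp
  qed
  then show "summable (\<lambda>n. (r n)^2)"
    by (rule summable_comparison_test_ev)
      (use \<gamma> in \<open>auto intro!: summable_mult simp: summable_real_powr_iff\<close>)
  have "eventually (\<lambda>n. c / 2 < real n powr \<gamma> * r n) sequentially"
    using lim by (rule order_tendstoD) (use c in auto)
  then have ev: "eventually (\<lambda>n. norm (real n powr (- 1)) \<le> 2 / c * r n) sequentially"
    using eventually_gt_at_top[of 0]
  proof eventually_elim
    case (elim n)
    have "real n powr (- 1) \<le> real n powr (- \<gamma>)"
      using elim \<gamma> by (intro powr_mono) auto
    also have "\<dots> \<le> 2 / c * r n"
      using elim c by (simp add: powr_minus field_simps)
    finally show ?case by simp
  qed
  show "\<not> summable r"
  proof
    assume "summable r"
    then have "summable (\<lambda>n. real n powr (- 1))"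
      by (intro summable_comparison_test_ev[OF ev] summable_mult)
    moreover have "\<not> summable (\<lambda>n. real n powr (- 1))"
      by (subst summable_real_powr_iff) simp
    ultimately show False by contradiction
  qed
qed

lemma tendsto_0_if_summable_squares:
  fixes r :: "nat \<Rightarrow> real"
  shows "summable (\<lambda>n. (r n)^2) \<Longrightarrow> r \<longlonglongrightarrow> 0"
  using tendsto_real_sqrt[OF summable_LIMSEQ_zero, of "\<lambda>n. (r n)^2"] by (simp add: tendsto_rabs_zero_iff)

theorem theorem3p1:
  fixes M :: "'a measure"
    and W :: "real ^ 'n ^ 'n"
    and r :: "nat \<Rightarrow> real"
    and c \<gamma> :: real
    and Z X :: "nat \<Rightarrow> 'a \<Rightarrow> real ^ 'n"
  assumes prob: "prob_space M"
    and W_nonneg: "\<And>j k. 0 \<le> W $ j $ k"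
    and W_stochastic: "transpose W *v 1 = 1"
    and W_irreducible: "irreducible_matrix W"
    and W_diagonalizable: "diagonalizable_matrix (map_matrix complex_of_real W)"
    and r_bounds: "\<And>n. 0 \<le> r n \<and> r n < 1"
    and r_limit: "(\<lambda>n. real n powr \<gamma> * r n) \<longlonglongrightarrow> c"
    and c_pos: "c > 0"
    and gamma_bounds: "1 / 2 < \<gamma>" "\<gamma> \<le> 1"
    and Z0_measurable: "Z 0 \<in> borel_measurable M"
    and Z0_range: "\<And>\<omega> j. \<omega> \<in> space M \<Longrightarrow> Z 0 \<omega> $ j \<in> {0..1}"
    and X_measurable: "\<And>n. n \<ge> 1 \<Longrightarrow> X n \<in> borel_measurable M"
    and X_range: "\<And>n \<omega> j. n \<ge> 1 \<Longrightarrow> \<omega> \<in> space M \<Longrightarrow> X n \<omega> $ j \<in> {0, 1}"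
    and X_cond_indep: "\<And>n. cond_indep_vars M (history_algebra M (Z 0) X n)
      (\<lambda>_. borel) (\<lambda>j \<omega>. X (Suc n) \<omega> $ j) UNIV"
    and X_cond_prob: "\<And>n j. AE \<omega> in M.
      cond_prob_given M (history_algebra M (Z 0) X n) {\<eta> \<in> space M. X (Suc n) \<eta> $ j = 1} \<omega> =
        (\<Sum>k\<in>UNIV. W $ k $ j * Z n \<omega> $ k)"
    and Z_step: "\<And>n \<omega>. \<omega> \<in> space M \<Longrightarrow>
      Z (Suc n) \<omega> = (1 - r n) *\<^sub>R Z n \<omega> + r n *\<^sub>R X (Suc n) \<omega>"
  shows "\<exists>Zinf :: 'a \<Rightarrow> real. Zinf \<in> borel_measurable M \<and>
    (\<forall>\<omega>\<in>space M. Zinf \<omega> \<in> {0..1}) \<and>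
    (AE \<omega> in M. (\<lambda>n. Z n \<omega>) \<longlonglongrightarrow> Zinf \<omega> *\<^sub>R 1)"
proof -
  interpret prob_space M by (rule prob)
  let ?F = "history_algebra M (Z 0) X"
  define P where "P n j \<omega> = (\<Sum>k\<in>UNIV. W $ k $ j * Z n \<omega> $ k)" for n j \<omega>
  \<comment> \<open>\<open>P n j\<close> is the conditional probability of a one, so
    \<open>D j n\<close> is the centred innovation scaled by \<open>r n\<close>. It involves
    \<open>X (Suc n)\<close> and therefore belongs to stage \<open>Suc n\<close> of the
    filtration.\<close>
  define D where "D j n \<omega> = r n * (X (Suc n) \<omega> $ j - P n j \<omega>)" for j n \<omega>
  have col: "(\<Sum>k\<in>UNIV. W $ k $ j) = 1" for j
    using arg_cong[OF W_stochastic, of "\<lambda>v. v $ j"] by (simp add: matrix_vector_mult_def transpose_def)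
  have sub: "subalgebra M (?F n)" for n
    by (intro subalgebra_history_algebra Z0_measurable X_measurable) auto
  have comp: "(\<lambda>\<omega>. f \<omega> $ j) \<in> borel_measurable N"
    if "f \<in> borel_measurable N" for f :: "'a \<Rightarrow> real ^ 'n" and j N
    using borel_measurable_continuous_onI[OF continuous_on_component[OF continuous_on_id], of j]
      measurable_compose[OF that] by blast
  have Z_F: "Z n \<in> borel_measurable (?F n)" for n
  proof (induction n)
    case (Suc n)
    have "subalgebra (?F (Suc n)) (?F n)"
      by (simp add: subalgebra_def space_history_algebra sets_history_algebra_mono)
    then have [measurable]: "Z n \<in> borel_measurable (?F (Suc n))"
      using Suc measurable_from_subalg by blast
    have [measurable]: "X (Suc n) \<in> borel_measurable (?F (Suc n))"
      by (rule step_measurable_history_algebra) auto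
    have "(\<lambda>\<omega>. (1 - r n) *\<^sub>R Z n \<omega> + r n *\<^sub>R X (Suc n) \<omega>) \<in> borel_measurable (?F (Suc n))"
      by measurable
    then show ?case
      by (subst measurable_cong_history[OF Z_step])
  qed (rule initial_measurable_history_algebra)
  have Z_M: "Z n \<in> borel_measurable M" for n
    using measurable_from_subalg[OF sub Z_F] .
  have Z_range: "Z n \<omega> $ j \<in> {0..1}" if om: "\<omega> \<in> space M" for n \<omega> j
  proof (induction n)
    case (Suc n)
    have x: "X (Suc n) \<omega> $ j \<in> {0..1}" using X_range[of "Suc n" \<omega> j] om by auto
    have "(1 - r n) * Z n \<omega> $ j + r n * X (Suc n) \<omega> $ j \<le> (1 - r n) * 1 + r n * 1"
      using Suc x r_bounds[of n] by (intro add_mono mult_left_mono) auto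
    then show ?case using Suc x r_bounds[of n] by (simp add: Z_step[OF om])
  qed (rule Z0_range[OF om])
  have P_F: "P n j \<in> borel_measurable (?F n)" for n j
    unfolding P_def using comp[OF Z_F] by (intro borel_measurable_sum borel_measurable_times) auto
  have P_range: "P n j \<omega> \<in> {0..1}" if om: "\<omega> \<in> space M" for n j \<omega>
  proof -
    have "P n j \<omega> \<le> (\<Sum>k\<in>UNIV. W $ k $ j * 1)"
      unfolding P_def using Z_range[OF om] W_nonneg by (intro sum_mono mult_left_mono) auto
    then show ?thesis
      using Z_range[OF om] W_nonneg by (auto simp: P_def col intro!: sum_nonneg mult_nonneg_nonneg)
  qed
  have D_F: "D j n \<in> borel_measurable (?F (Suc n))" for j n
  proof -
    have "subalgebra (?F (Suc n)) (?F n)"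
      by (simp add: subalgebra_def space_history_algebra sets_history_algebra_mono)
    then have "P n j \<in> borel_measurable (?F (Suc n))"
      using P_F measurable_from_subalg by blast
    moreover have "X (Suc n) \<in> borel_measurable (?F (Suc n))"
      by (rule step_measurable_history_algebra) auto
    ultimately show ?thesis
      unfolding D_def using comp by (intro borel_measurable_times borel_measurable_diff) auto
  qed
  have D_bound: "\<bar>D j n \<omega>\<bar> \<le> r n" if om: "\<omega> \<in> space M" for j n \<omega>
  proof -
    have "\<bar>X (Suc n) \<omega> $ j - P n j \<omega>\<bar> \<le> 1"
      using X_range[of "Suc n" \<omega> j] P_range[OF om, of n j] om by auto
    then have "r n * \<bar>X (Suc n) \<omega> $ j - P n j \<omega>\<bar> \<le> r n * 1"
      using r_bounds[of n] by (intro mult_left_mono) auto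
    then show ?thesis using r_bounds[of n] by (simp add: D_def abs_mult)
  qed
  have orth: "expectation (\<lambda>\<omega>. G \<omega> * D j n \<omega>) = 0"
    if G: "G \<in> borel_measurable (?F n)" and GC: "\<And>\<omega>. \<omega> \<in> space M \<Longrightarrow> \<bar>G \<omega>\<bar> \<le> C" for G C n j
  proof -
    interpret F: finite_measure_subalgebra M "?F n"
      by (simp add: finite_measure_subalgebra_def finite_measure_subalgebra_axioms_def sub finite_measure_axioms)
    let ?I = "indicator {\<eta> \<in> space M. X (Suc n) \<eta> $ j = 1} :: 'a \<Rightarrow> real"
    have [measurable]: "(\<lambda>\<omega>. X (Suc n) \<omega> $ j) \<in> borel_measurable M"
      by (intro comp X_measurable) auto
    have [measurable]: "G \<in> borel_measurable M" "P n j \<in> borel_measurable M"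
      using measurable_from_subalg[OF sub G] measurable_from_subalg[OF sub P_F] by simp_all
    \<comment> \<open>A variable with values 0 and 1 is the indicator of its value 1, which turns
      the conditional probability into a conditional expectation of the variable itself.\<close>
    have XI: "X (Suc n) \<omega> $ j = ?I \<omega>" if "\<omega> \<in> space M" for \<omega>
      using X_range[of "Suc n" \<omega> j] that by (auto simp: indicator_def)
    have GI: "integrable M (\<lambda>\<omega>. G \<omega> * ?I \<omega>)"
      using GC by (intro Bochner_Integration.integrable_bound[OF integrable_const[of C]] AE_I2)
        (force simp: indicator_def)+
    have I_M: "?I \<in> borel_measurable M" by measurable
    have cond: "AE \<omega> in M. G \<omega> * real_cond_exp M (?F n) ?I \<omega> = G \<omega> * P n j \<omega>"
      using X_cond_prob[of n j] unfolding cond_prob_given_def P_def by eventually_elim simp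
    \<comment> \<open>Integrability and the integral of \<open>G\<close> times the conditional
      expectation come from its defining property; the almost sure equality \<open>cond\<close>
      transfers them to \<open>P n j\<close>.\<close>
    have GP: "integrable M (\<lambda>\<omega>. G \<omega> * P n j \<omega>)"
      using F.real_cond_exp_intg(1)[OF GI G I_M]
      by (subst integrable_cong_AE[OF _ _ cond, symmetric]) auto
    have "expectation (\<lambda>\<omega>. G \<omega> * D j n \<omega>)
        = expectation (\<lambda>\<omega>. r n * (G \<omega> * ?I \<omega> - G \<omega> * P n j \<omega>))"
      by (intro Bochner_Integration.integral_cong refl) (simp only: D_def XI, simp add: algebra_simps)
    also have "\<dots> = r n * (expectation (\<lambda>\<omega>. G \<omega> * ?I \<omega>) - expectation (\<lambda>\<omega>. G \<omega> * P n j \<omega>))"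
      using GI GP by simp
    also have "expectation (\<lambda>\<omega>. G \<omega> * P n j \<omega>)
        = expectation (\<lambda>\<omega>. G \<omega> * real_cond_exp M (?F n) ?I \<omega>)"
      by (rule integral_cong_AE[symmetric]) (use cond in auto)
    also have "\<dots> = expectation (\<lambda>\<omega>. G \<omega> * ?I \<omega>)"
      by (rule F.real_cond_exp_intg(2)[OF GI G I_M])
    finally show ?thesis by simp
  qed
  note r_sum = polynomial_step_size[OF _ r_limit c_pos gamma_bounds]
  have r2: "summable (\<lambda>n. (r n)^2)" and r1: "\<not> summable r"
    using r_sum r_bounds by auto
  have "AE \<omega> in M. summable (\<lambda>n. D j n \<omega>)" for j
  proof (rule martingale_differences_AE_summable[where F = ?F and d = r])
    show "sets (?F n) \<subseteq> sets (?F (Suc n))" for n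
      by (rule sets_history_algebra_mono) simp
    show "expectation (\<lambda>\<omega>. G \<omega> * D j n \<omega>) = 0"
      if "G \<in> borel_measurable (?F n)" "\<And>\<omega>. \<omega> \<in> space M \<Longrightarrow> \<bar>G \<omega>\<bar> \<le> C" for G C n
      using that by (rule orth)
  qed (rule sub D_F D_bound r2; assumption?)+
  then have D_summable: "AE \<omega> in M. \<forall>j. summable (\<lambda>n. D j n \<omega>)"
    by (rule eventually_all_finite)
  obtain p :: "real ^ 'n" where p: "\<And>i. 0 < p $ i" "sum (($) p) UNIV = 1" "W *v p = p"
    using perron_vector_exists[OF W_nonneg W_stochastic W_irreducible] by blast
  have Wp: "(\<Sum>j\<in>UNIV. W $ k $ j * p $ j) = p $ k" for k
    using arg_cong[OF p(3), of "\<lambda>v. v $ k"] by (simp add: matrix_vector_mult_def)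
  have conv: "\<exists>L. \<forall>j. (\<lambda>n. Z n \<omega> $ j) \<longlonglongrightarrow> L"
    if om: "\<omega> \<in> space M" and D: "\<forall>j. summable (\<lambda>n. D j n \<omega>)" for \<omega>
  proof (rule stochastic_approximation_consensus[where w = "\<lambda>k j. W $ k $ j" and p = "($) p"
        and r = r and D = "\<lambda>n j. D j n \<omega>"])
    show "Z (Suc n) \<omega> $ j = Z n \<omega> $ j + r n * ((\<Sum>k\<in>UNIV. W $ k $ j * Z n \<omega> $ k) - Z n \<omega> $ j) + D j n \<omega>" for n j
      by (simp add: Z_step[OF om] D_def P_def algebra_simps)
    show "(i, j) \<in> {(k, l). W $ k $ l \<noteq> 0}\<^sup>*" for i j
      using W_irreducible unfolding irreducible_matrix_def by blast
    show "r \<longlonglongrightarrow> 0" using r2 by (rule tendsto_0_if_summable_squares)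
    show "0 \<le> r n" for n using r_bounds by blast
    show "summable (\<lambda>n. D j n \<omega>)" for j using D by blast
  qed (rule W_nonneg col p Wp r1 Z_range[OF om])+
  define j0 :: 'n where "j0 = undefined"
  \<comment> \<open>All coordinates share one limit, so any \<open>j0\<close> serves. Off the
    convergence set \<open>lim\<close> is an unspecified real; clamping puts \<open>Zinf\<close> in
    the unit interval everywhere and leaves genuine limits unchanged.\<close>
  define Zinf where "Zinf \<omega> = max 0 (min 1 (lim (\<lambda>n. Z n \<omega> $ j0)))" for \<omega>
  show ?thesis
  proof (intro exI[of _ Zinf] conjI ballI)
    have [measurable]: "(\<lambda>\<omega>. Z n \<omega> $ j0) \<in> borel_measurable M" for n
      by (rule comp[OF Z_M])
    show "Zinf \<in> borel_measurable M" unfolding Zinf_def by measurable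
    show "Zinf \<omega> \<in> {0..1}" for \<omega> by (simp add: Zinf_def)
    show "AE \<omega> in M. (\<lambda>n. Z n \<omega>) \<longlonglongrightarrow> Zinf \<omega> *\<^sub>R 1"
      using AE_space D_summable
    proof eventually_elim
      case (elim \<omega>)
      then obtain L where L: "\<And>j. (\<lambda>n. Z n \<omega> $ j) \<longlonglongrightarrow> L" using conv by blast
      have "L \<in> {0..1}"
        using Z_range[OF elim(1)] by (intro Lim_in_closed_set[OF _ _ _ L]) auto
      then have "Zinf \<omega> = L" using limI[OF L[of j0]] by (simp add: Zinf_def)
      then show ?case using L by (intro vec_tendstoI) simp
    qed
  qed
qed

end
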